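(* Let $0<s<\tfrac12$, $\lambda>0$, and set $y=\big(\frac{1-2s}{\lambda}\big)^{\frac{1-2s}{2s}}s$. Let $u_0\in E^1_{\mathcal F}\big(1,1,\lambda,(\log_+x)^{\frac1{1-2s}}\big)$ and let $u(x,t)$ be the solution of $\frac1i\partial_tu=(-\partial_x^2+x^2)u$, $u(\cdot,0)=u_0$. Then for every $\epsilon>0$: (1) If $\lambda<\lambda_s$, then for all $t\in\mathbb R$ and all real $x$ with $|x|$ sufficiently large, $$|u(x,t)|\le C\exp\Big(-(1-\epsilon)\Big(\tfrac{x^2}{2}P_{s,y}(x)-\lambda2^{\frac{2s}{1-2s}}(\log_+\sqrt{2x})^{\frac1{1-2s}}\Big)\Big),$$ with $C$ independent of $x,t$; the same estimate holds for $\hat u(x,t)$. (2) Let $\theta:(0,2^{\frac1{2s}-1}]\to[0,1]$ be continuous with $\theta(r)\le\frac{(2r)^{2s}}2$. If $\lambda\ge\lambda_s$, then for all $t\in\mathbb R$ and all real $x$ with $|x|$ sufficiently large, $$|u(x,t)|\le C\exp\Big(-(1-\epsilon)\theta(y)^{\frac1{2s}}\Big(\tfrac{x^2}{2}P_{s,y}(x)-\lambda2^{\frac{2s}{1-2s}}(\log_+\sqrt{2x})^{\frac1{1-2s}}\Big)\Big),$$ and the same estimate holds for $\hat u(x,t)$.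
   Context: Fourier transform $\hat f(\xi)=(2\pi)^{-1/2}\int e^{-i\xi x}f(x)dx$; $\hat u(x,t)$ is the Fourier transform of $u(\cdot,t)$. A weight function is an unbounded non-decreasing $w:[0,\infty)\to[0,\infty)$; $E^1_{\mathcal F}(a,c,\lambda,w)$ is the set of $f\in(L^1\cap L^2)(\mathbb R)$ with $|f(x)|\le Ce^{-ax^2/2+\lambda w(c|x|)}$ and $|\hat f(\xi)|\le Ce^{-a\xi^2/2+\lambda w(c|\xi|)}$ for some $C$. $\log_+x=\log(1+|x|)$, and $\log_+\sqrt{2x}$ means $\log(1+\sqrt{2|x|})$. The solution is $u(\cdot,t)=\sum_{n\ge0}e^{i(2n+1)t}\langle u_0,h_n\rangle h_n$, where $h_n$ are the Hermite functions $h_n(x)=(-1)^n(2^nn!\sqrt\pi)^{-1/2}e^{x^2/2}\frac{d^n}{dx^n}e^{-x^2}$. $P_{s,y}(x)=\sqrt{1-\frac{2}{x^2}\big(\frac{2s}{y}\log_+\sqrt{2x}\big)^{\frac{2s}{1-2s}}}$ (for $|x|$ large) and $\lambda_s=\frac12(1-2s)s^{\frac{2s}{1-2s}}$. *)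

theory Defs
  imports "HOL-Analysis.Analysis"
begin

definition logp :: "real \<Rightarrow> real" where
  "logp x = ln (1 + \<bar>x\<bar>)"

definition fourier :: "(real \<Rightarrow> complex) \<Rightarrow> real \<Rightarrow> complex" where
  "fourier f \<xi> = complex_of_real (1 / sqrt (2 * pi)) *
      (LINT x|lborel. cis (- (\<xi> * x)) * f x)"

definition E1F :: "real \<Rightarrow> real \<Rightarrow> real \<Rightarrow> (real \<Rightarrow> real) \<Rightarrow> (real \<Rightarrow> complex) set" where
  "E1F a c lam w = {f. integrable lborel f \<and>
      integrable lborel (\<lambda>x. (cmod (f x))\<^sup>2) \<and>
      (\<exists>C. (\<forall>x. cmod (f x) \<le> C * exp (- a * x\<^sup>2 / 2 + lam * w (c * \<bar>x\<bar>))) \<and>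
           (\<forall>\<xi>. cmod (fourier f \<xi>) \<le> C * exp (- a * \<xi>\<^sup>2 / 2 + lam * w (c * \<bar>\<xi>\<bar>))))}"

definition hermite_fun :: "nat \<Rightarrow> real \<Rightarrow> real" where
  "hermite_fun n x = (-1) ^ n * (1 / sqrt (2 ^ n * fact n * sqrt pi)) *
      exp (x\<^sup>2 / 2) * (deriv ^^ n) (\<lambda>z. exp (- (z\<^sup>2))) x"

text \<open>L^2 inner product <f, h_n> (h_n is real-valued)\<close>
definition hermite_coeff :: "(real \<Rightarrow> complex) \<Rightarrow> nat \<Rightarrow> complex" where
  "hermite_coeff f n = (LINT x|lborel. f x * complex_of_real (hermite_fun n x))"

text \<open>Solution of (1/i) u_t = (-u_xx + x^2) u, u(.,0) = u0:
  u(x,t) = sum_n e^(i(2n+1)t) <u0,h_n> h_n(x)\<close>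
definition hermite_sol :: "(real \<Rightarrow> complex) \<Rightarrow> real \<Rightarrow> real \<Rightarrow> complex" where
  "hermite_sol u0 x t = (\<Sum>n. cis ((2 * real n + 1) * t) * hermite_coeff u0 n *
      complex_of_real (hermite_fun n x))"

definition P_sy :: "real \<Rightarrow> real \<Rightarrow> real \<Rightarrow> real" where
  "P_sy s y x = sqrt (1 - (2 / x\<^sup>2) *
      ((2 * s / y) * ln (1 + sqrt (2 * \<bar>x\<bar>))) powr (2 * s / (1 - 2 * s)))"

definition lambda_s :: "real \<Rightarrow> real" where
  "lambda_s s = (1 / 2) * (1 - 2 * s) * s powr (2 * s / (1 - 2 * s))"

definition expo :: "real \<Rightarrow> real \<Rightarrow> real \<Rightarrow> real \<Rightarrow> real" where
  "expo s lam y x = x\<^sup>2 / 2 * P_sy s y x -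
      lam * 2 powr (2 * s / (1 - 2 * s)) * (ln (1 + sqrt (2 * \<bar>x\<bar>))) powr (1 / (1 - 2 * s))"

end

theory Submission
  imports Defs "HOL-Probability.Probability" "HOL-Complex_Analysis.Complex_Analysis"
    "HOL-Real_Asymp.Real_Asymp"
begin

text \<open>
  The exponent in the claim is at most \<open>x\<^sup>2 / 2\<close> and nonnegative for large \<open>|x|\<close>, so it suffices
  to bound \<open>u\<close> and its Fourier transform by \<open>C exp (- m x\<^sup>2 / 2)\<close> for every \<open>m < 1\<close>.

  The Bargmann transform \<open>F\<close> of \<open>u0\<close> is entire with Taylor coefficients
  \<open>\<langle>u0, h\<^sub>n\<rangle> / sqrt (n!)\<close>. For each \<open>d > 0\<close>, Gaussian decay of \<open>u0\<close> gives
  \<open>|F(a + i b)| \<le> C exp (d a\<^sup>2 + b\<^sup>2 / 2)\<close>; decay of the Fourier transform of \<open>u0\<close>, whose Bargmann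
  transform is \<open>F(-i z)\<close>, gives the same bound with \<open>a\<close> and \<open>b\<close> exchanged. By Phragmen--Lindelof in
  the sector of each quadrant that stays slightly away from the axes, \<open>|F(z)| \<le> C exp (k |z|\<^sup>2)\<close> for
  every \<open>k > 0\<close>. Cauchy's estimates then show that \<open>\<langle>u0, h\<^sub>n\<rangle>\<close> decays faster than every
  exponential, while Cauchy's estimates for the generating function of the \<open>h\<^sub>n\<close> give
  \<open>|h\<^sub>n(x)| \<le> exp (- (1 - e) x\<^sup>2 / 2 + K (n + 1))\<close> with \<open>K\<close> depending only on \<open>e\<close>, so the Hermite
  expansion can be summed termwise. The Fourier transform only multiplies the terms by
  \<open>(-i)\<^sup>n\<close>.
\<close>

section \<open>The generating function of the Hermite functions\<close>

text \<open>Normalised so that the transform of \<open>h_n\<close> is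
  \<open>z^n / sqrt (n!)\<close>.\<close>

definition bargmann_kernel :: "real \<Rightarrow> complex \<Rightarrow> complex" where
  "bargmann_kernel x z = complex_of_real (1 / sqrt (sqrt pi)) *
     exp (- (of_real x)\<^sup>2 / 2 + of_real (sqrt 2 * x) * z - z\<^sup>2 / 2)"

text \<open>Bridges the real derivatives in \<open>hermite_fun\<close> and the complex Taylor series
  used below. Along the real axis the holomorphic derivative is a vector derivative of a real-valued
  function, so its imaginary part vanishes and its real part is the real derivative.\<close>

lemma higher_deriv_gaussian_of_real:
  "complex_of_real ((deriv ^^ n) (\<lambda>z. exp (- (z\<^sup>2))) x) = (deriv ^^ n) (\<lambda>z. exp (- (z\<^sup>2))) (of_real x)"
proof (induction n arbitrary: x)
  case (Suc n)
  let ?G = "(deriv ^^ n) (\<lambda>z::complex. exp (- (z\<^sup>2)))"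
  let ?g = "(deriv ^^ n) (\<lambda>z::real. exp (- (z\<^sup>2)))"
  have "?G holomorphic_on UNIV"
    by (intro holomorphic_higher_deriv holomorphic_intros) auto
  then have "(?G has_field_derivative deriv ?G (of_real x)) (at (of_real x))"
    by (intro holomorphic_derivI[of _ UNIV]) auto
  then have "((\<lambda>x. ?G (of_real x)) has_vector_derivative deriv ?G (of_real x)) (at x)"
    by (rule has_vector_derivative_real_field)
  then have *: "((\<lambda>x. of_real (?g x)) has_vector_derivative deriv ?G (of_real x)) (at x)"
    by (simp add: Suc)
  have re: "(?g has_vector_derivative Re (deriv ?G (of_real x))) (at x)"
    using bounded_linear.has_vector_derivative[OF bounded_linear_Re *] by simp
  have im: "((\<lambda>_. 0::real) has_vector_derivative Im (deriv ?G (of_real x))) (at x)"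
    using bounded_linear.has_vector_derivative[OF bounded_linear_Im *] by simp
  have "deriv ?g x = Re (deriv ?G (of_real x))"
    using re by (simp add: DERIV_imp_deriv has_real_derivative_iff_has_vector_derivative)
  moreover have "Im (deriv ?G (of_real x)) = 0"
    using vector_derivative_unique_at[OF im has_vector_derivative_const] .
  ultimately show ?case
    by (simp add: complex_eq_iff)
qed (simp flip: exp_of_real)

text \<open>Taylor expansion of \<open>exp (- w^2)\<close> about x, evaluated at
  \<open>w = x - z / sqrt 2\<close>. The powers of the displacement produce the sign and the
  \<open>sqrt (2^n)\<close> in \<open>h_n\<close>, and the prefactor \<open>exp (x^2 / 2)\<close>
  turns \<open>- w^2\<close> into the exponent of the kernel.\<close>

lemma hermite_fun_generating_function:
  "(\<lambda>n. complex_of_real (hermite_fun n x / sqrt (fact n)) * z ^ n) sums bargmann_kernel x z"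
proof -
  let ?g = "\<lambda>z::complex. exp (- (z\<^sup>2))"
  let ?w = "of_real x - z / of_real (sqrt 2)"
  have "?g holomorphic_on ball (of_real x) (norm z + 1)"
    by (intro holomorphic_intros)
  moreover have "?w \<in> ball (of_real x) (norm z + 1)"
  proof -
    have "norm z / sqrt 2 \<le> norm z"
      by (simp add: divide_le_eq mult_le_cancel_left1)
    then show ?thesis by (simp add: dist_norm norm_divide)
  qed
  ultimately have "(\<lambda>n. (deriv ^^ n) ?g (of_real x) / fact n * (?w - of_real x) ^ n) sums ?g ?w"
    by (rule holomorphic_power_series)
  then have "(\<lambda>n. complex_of_real (exp (x\<^sup>2 / 2) / sqrt (sqrt pi)) *
      ((deriv ^^ n) ?g (of_real x) / fact n * (?w - of_real x) ^ n))
     sums (complex_of_real (exp (x\<^sup>2 / 2) / sqrt (sqrt pi)) * ?g ?w)"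
    by (rule sums_mult)
  moreover have "complex_of_real (exp (x\<^sup>2 / 2) / sqrt (sqrt pi)) * ?g ?w = bargmann_kernel x z"
  proof -
    have sq: "complex_of_real (sqrt 2) * complex_of_real (sqrt 2) = 2"
      by (simp flip: of_real_mult)
    have "(of_real x)\<^sup>2 / 2 + - (?w\<^sup>2) = - (of_real x)\<^sup>2 / 2 + of_real (sqrt 2 * x) * z - z\<^sup>2 / 2"
      using sq by (simp add: power2_eq_square field_simps)
    then have "exp ((of_real x)\<^sup>2 / 2) * ?g ?w =
        exp (- (of_real x)\<^sup>2 / 2 + of_real (sqrt 2 * x) * z - z\<^sup>2 / 2)"
      by (metis exp_add)
    then show ?thesis
      by (simp add: bargmann_kernel_def flip: exp_of_real)
  qed
  moreover have "complex_of_real (exp (x\<^sup>2 / 2) / sqrt (sqrt pi)) *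
      ((deriv ^^ n) ?g (of_real x) / fact n * (?w - of_real x) ^ n) =
      complex_of_real (hermite_fun n x / sqrt (fact n)) * z ^ n" for n
  proof -
    have f: "complex_of_real (sqrt (fact n)) * complex_of_real (sqrt (fact n)) = fact n"
      by (simp flip: of_real_mult)
    have "(?w - of_real x) ^ n = (-1) ^ n * z ^ n / of_real (sqrt 2) ^ n"
      by (simp add: power_divide power_minus')
    then show ?thesis
      unfolding hermite_fun_def higher_deriv_gaussian_of_real[symmetric]
      by (simp add: real_sqrt_mult real_sqrt_power f[symmetric] field_simps)
  qed
  ultimately show ?thesis by simp
qed

section \<open>Entire power series and Cauchy's estimates\<close>

lemma entire_power_series:
  fixes a :: "nat \<Rightarrow> complex"
  assumes "\<And>z. (\<lambda>n. a n * z ^ n) sums F z"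
  shows entire_power_series_holomorphic: "F holomorphic_on UNIV"
    and entire_power_series_coeff: "a n = (deriv ^^ n) F 0 / fact n"
proof -
  have *: "F has_fps_expansion Abs_fps a"
    by (rule has_fps_expansionI) (simp add: assms)
  then show "a n = (deriv ^^ n) F 0 / fact n"
    using fps_nth_fps_expansion[OF *, of n] by simp
  have "F holomorphic_on ball 0 r" for r
    by (rule power_series_holomorphic[of _ _ a]) (simp add: assms)
  then have "F field_differentiable at z" for z
    using holomorphic_on_imp_differentiable_at[of F "ball 0 (norm z + 1)" z] by simp
  then show "F holomorphic_on UNIV"
    by (simp add: holomorphic_on_def field_differentiable_at_within)
qed

lemma entire_power_series_Cauchy:
  fixes a :: "nat \<Rightarrow> complex"
  assumes "\<And>z. (\<lambda>n. a n * z ^ n) sums F z" and "r > 0"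
    and "\<And>z. norm z = r \<Longrightarrow> norm (F z) \<le> B"
  shows "norm (a n) \<le> B / r ^ n"
proof -
  have "F holomorphic_on UNIV"
    using assms(1) by (rule entire_power_series_holomorphic)
  then have "norm ((deriv ^^ n) F 0) \<le> fact n * B / r ^ n"
    using assms by (intro Cauchy_inequality)
      (auto intro: holomorphic_on_subset holomorphic_on_imp_continuous_on)
  then show ?thesis
    by (simp add: entire_power_series_coeff[OF assms(1)] norm_divide divide_le_eq mult.commute)
qed

text \<open>Two forms of one exponent: the completed square, centred at
  \<open>Re z / sqrt 2\<close>, serves integration in x; the expanded form serves the bound through
  \<open>norm z\<close> alone.\<close>

lemma norm_bargmann_kernel:
  "norm (bargmann_kernel x z) = exp (- (x - Re z / sqrt 2)\<^sup>2 + (x\<^sup>2 + (Im z)\<^sup>2) / 2) / sqrt (sqrt pi)"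
  "norm (bargmann_kernel x z) = exp (- x\<^sup>2 / 2 + sqrt 2 * x * Re z - ((Re z)\<^sup>2 - (Im z)\<^sup>2) / 2) / sqrt (sqrt pi)"
proof -
  show *: "norm (bargmann_kernel x z) = exp (- x\<^sup>2 / 2 + sqrt 2 * x * Re z - ((Re z)\<^sup>2 - (Im z)\<^sup>2) / 2) / sqrt (sqrt pi)"
    by (simp add: bargmann_kernel_def norm_mult norm_divide power2_eq_square)
  have "- x\<^sup>2 / 2 + sqrt 2 * x * Re z - ((Re z)\<^sup>2 - (Im z)\<^sup>2) / 2 =
      - (x - Re z / sqrt 2)\<^sup>2 + (x\<^sup>2 + (Im z)\<^sup>2) / 2"
    by (simp add: power2_diff power_divide field_simps)
  then show "norm (bargmann_kernel x z) = exp (- (x - Re z / sqrt 2)\<^sup>2 + (x\<^sup>2 + (Im z)\<^sup>2) / 2) / sqrt (sqrt pi)"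
    using * by simp
qed

text \<open>Young's inequality splits the cross term \<open>sqrt 2 * x * Re z\<close>, giving up a
  fraction e of the Gaussian decay in x at a cost of \<open>1 / e\<close> in the growth in
  z.\<close>

lemma norm_bargmann_kernel_le:
  assumes "0 < e"
  shows "norm (bargmann_kernel x z) \<le> exp (- (1 - e) * x\<^sup>2 / 2 + (1 / 2 + 1 / e) * (norm z)\<^sup>2)"
proof -
  have "sqrt 2 * x * Re z \<le> e * x\<^sup>2 / 2 + (Re z)\<^sup>2 / e"
  proof -
    have "0 \<le> (e * x - sqrt 2 * Re z)\<^sup>2" by simp
    also have "\<dots> = 2 * e * (e * x\<^sup>2 / 2 + (Re z)\<^sup>2 / e - sqrt 2 * x * Re z)"
      using assms by (simp add: power2_diff power_mult_distrib field_simps)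
        (simp add: power2_eq_square)
    finally show ?thesis using assms by (simp add: zero_le_mult_iff)
  qed
  also have "\<dots> \<le> e * x\<^sup>2 / 2 + (norm z)\<^sup>2 / e"
    using assms by (simp add: cmod_power2 divide_right_mono)
  finally have "sqrt 2 * x * Re z \<le> e * x\<^sup>2 / 2 + (norm z)\<^sup>2 / e" .
  moreover have "- ((Re z)\<^sup>2 - (Im z)\<^sup>2) / 2 \<le> (norm z)\<^sup>2 / 2"
    by (simp add: cmod_power2)
  ultimately have *: "sqrt 2 * x * Re z + - ((Re z)\<^sup>2 - (Im z)\<^sup>2) / 2
      \<le> e * x\<^sup>2 / 2 + (norm z)\<^sup>2 / e + (norm z)\<^sup>2 / 2"
    by (rule add_mono)
  have "- x\<^sup>2 / 2 + sqrt 2 * x * Re z - ((Re z)\<^sup>2 - (Im z)\<^sup>2) / 2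
      \<le> - (1 - e) * x\<^sup>2 / 2 + (1 / 2 + 1 / e) * (norm z)\<^sup>2"
  proof -
    have "- (1 - e) * x\<^sup>2 / 2 + (1 / 2 + 1 / e) * (norm z)\<^sup>2 =
        - x\<^sup>2 / 2 + e * x\<^sup>2 / 2 + (norm z)\<^sup>2 / 2 + (norm z)\<^sup>2 / e"
      using assms by (simp add: field_simps)
    with * show ?thesis by (simp add: diff_divide_distrib)
  qed
  moreover have "1 \<le> sqrt (sqrt pi)"
    using pi_gt3 by simp
  then have "norm (bargmann_kernel x z) \<le>
      exp (- x\<^sup>2 / 2 + sqrt 2 * x * Re z - ((Re z)\<^sup>2 - (Im z)\<^sup>2) / 2)"
    unfolding norm_bargmann_kernel(2) by (simp add: divide_le_eq mult_le_cancel_left1)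
  ultimately show ?thesis
    by (meson exp_le_cancel_iff order_trans)
qed

text \<open>Cauchy's estimate for the generating function. The radius stays free: it is later tied
  either to n or to a point z.\<close>

lemma abs_hermite_fun_le:
  assumes "0 < e" "0 < r"
  shows "\<bar>hermite_fun n x\<bar> / sqrt (fact n) \<le> exp (- (1 - e) * x\<^sup>2 / 2) * (exp ((1 / 2 + 1 / e) * r\<^sup>2) / r ^ n)"
proof -
  have "norm (complex_of_real (hermite_fun n x / sqrt (fact n))) \<le>
      exp (- (1 - e) * x\<^sup>2 / 2 + (1 / 2 + 1 / e) * r\<^sup>2) / r ^ n"
    using norm_bargmann_kernel_le[OF assms(1)] assms
    by (intro entire_power_series_Cauchy[OF hermite_fun_generating_function]) auto
  then show ?thesis by (simp add: exp_add norm_divide)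
qed

text \<open>A crude substitute for Stirling's formula; the loss is only exponential in n. The shift
  to \<open>n + 1\<close> keeps the base positive at n = 0, so that it can serve as a
  radius.\<close>

lemma sqrt_fact_le: "sqrt (fact n) \<le> sqrt (real n + 1) ^ n"
proof -
  have "fact n \<le> (real n) ^ n"
    using fact_le_power[of n, where 'a = real] by simp
  also have "\<dots> \<le> (real n + 1) ^ n"
    by (intro power_mono) auto
  finally show ?thesis
    by (simp flip: real_sqrt_power add: add.commute)
qed

lemma abs_hermite_fun_le_exp:
  assumes "0 < e"
  shows "\<bar>hermite_fun n x\<bar> \<le> exp (- (1 - e) * x\<^sup>2 / 2) * exp ((1 / 2 + 1 / e) * (real n + 1))"
proof -
  \<comment> \<open>With this radius \<open>r^n\<close> cancels the bound on
    \<open>sqrt (n!)\<close>, leaving a factor exponential in n.\<close>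
  let ?r = "sqrt (real n + 1)"
  have r: "?r > 0" "?r\<^sup>2 = real n + 1" by auto
  have "\<bar>hermite_fun n x\<bar> = sqrt (fact n) * (\<bar>hermite_fun n x\<bar> / sqrt (fact n))"
    by simp
  also have "\<dots> \<le> ?r ^ n * (exp (- (1 - e) * x\<^sup>2 / 2) * (exp ((1 / 2 + 1 / e) * ?r\<^sup>2) / ?r ^ n))"
    by (intro mult_mono sqrt_fact_le abs_hermite_fun_le[OF assms r(1)]) auto
  also have "\<dots> = exp (- (1 - e) * x\<^sup>2 / 2) * exp ((1 / 2 + 1 / e) * (real n + 1))"
    using r by (simp del: real_sqrt_pow2)
  finally show ?thesis .
qed

section \<open>The Bargmann transform and the Fourier transform\<close>

lemma bargmann_kernel_measurable [measurable]:
  "(\<lambda>x. bargmann_kernel x z) \<in> borel_measurable borel"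
  unfolding bargmann_kernel_def by (intro borel_measurable_continuous_onI continuous_intros) auto

lemma hermite_fun_measurable [measurable]: "hermite_fun n \<in> borel_measurable borel"
proof -
  have "(deriv ^^ n) (\<lambda>z::complex. exp (- (z\<^sup>2))) holomorphic_on UNIV"
    by (intro holomorphic_higher_deriv holomorphic_intros) auto
  then have "continuous_on UNIV (\<lambda>x. (deriv ^^ n) (\<lambda>z. exp (- (z\<^sup>2))) (complex_of_real x))"
    by (rule continuous_on_compose2[OF holomorphic_on_imp_continuous_on continuous_on_of_real_id]) auto
  then have "continuous_on UNIV (\<lambda>x. Re (complex_of_real ((deriv ^^ n) (\<lambda>z. exp (- (z\<^sup>2))) x)))"
    unfolding higher_deriv_gaussian_of_real by (intro continuous_intros)
  then have "continuous_on UNIV (\<lambda>x::real. (deriv ^^ n) (\<lambda>z. exp (- (z\<^sup>2))) x)"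
    by simp
  then have [measurable]: "(deriv ^^ n) (\<lambda>z. exp (- (z\<^sup>2)) :: real) \<in> borel_measurable borel"
    by (intro borel_measurable_continuous_onI) simp
  show ?thesis
    unfolding hermite_fun_def by measurable
qed

section \<open>Gaussian domination and termwise integration\<close>

lemma integrable_gaussian:
  assumes "c > 0"
  shows "integrable lborel (\<lambda>x::real. exp (- c * (x - m)\<^sup>2))"
proof -
  define s where "s = sqrt (1 / (2 * c))"
  have s: "s > 0" "s\<^sup>2 = 1 / (2 * c)"
    using assms by (auto simp: s_def)
  have "integrable lborel (\<lambda>x. sqrt (2 * pi * s\<^sup>2) * normal_density m s x)"
    using s by (intro integrable_mult_right integrable_normal_density)
  moreover have "sqrt (2 * pi * s\<^sup>2) * normal_density m s x = exp (- c * (x - m)\<^sup>2)" for x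
    using s assms by (simp add: normal_density_def mult.commute)
  ultimately show ?thesis by simp
qed

text \<open>The dominating function \<open>exp (- x^2 / 4)\<close> is what the Hermite bounds give
  for e = 1/2.\<close>

lemma sums_integral_gaussian_bound:
  fixes f :: "nat \<Rightarrow> real \<Rightarrow> complex"
  assumes [measurable]: "\<And>n. f n \<in> borel_measurable lborel"
    and bd: "\<And>n x. norm (f n x) \<le> M n * exp (- x\<^sup>2 / 4)" and M: "summable M"
  shows "(\<lambda>n. LINT x|lborel. f n x) sums (LINT x|lborel. (\<Sum>n. f n x))"
proof -
  let ?g = "\<lambda>x::real. exp (- x\<^sup>2 / 4)"
  have g: "integrable lborel ?g"
    using integrable_gaussian[of "1 / 4" 0] by simp
  have int: "integrable lborel (f n)" for n
    by (rule Bochner_Integration.integrable_bound[where f = "\<lambda>x. M n * ?g x"])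
      (use g bd in \<open>auto intro!: AE_I2 intro: order_trans[OF _ abs_ge_self]\<close>)
  show ?thesis
  proof (rule sums_integral[OF int])
    show "AE x in lborel. summable (\<lambda>n. norm (f n x))"
    proof (rule AE_I2)
      fix x
      show "summable (\<lambda>n. norm (f n x))"
        using bd by (intro summable_comparison_test'[OF summable_mult2[OF M, of "?g x"]]) auto
    qed
    have "norm (LINT x|lborel. norm (f n x)) \<le> M n * (LINT x|lborel. ?g x)" for n
    proof -
      have "(LINT x|lborel. norm (f n x)) \<le> (LINT x|lborel. M n * ?g x)"
        using int g bd by (intro integral_mono) auto
      then show ?thesis by simp
    qed
    then show "summable (\<lambda>n. LINT x|lborel. norm (f n x))"
      by (intro summable_comparison_test'[OF summable_mult2[OF M]]) auto
  qed
qed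

text \<open>Integrates the generating function term by term against f. Bounded measurable f are
  allowed so that the characters \<open>cis (- (x * y))\<close> are covered as well as the initial
  datum.\<close>

lemma hermite_coeff_generating_function:
  assumes f[measurable]: "f \<in> borel_measurable lborel" and bd: "\<And>x. norm (f x) \<le> B"
  shows "(\<lambda>n. hermite_coeff f n / of_real (sqrt (fact n)) * z ^ n) sums
           (LINT x|lborel. f x * bargmann_kernel x z)"
proof -
  let ?h = "\<lambda>n x. f x * (complex_of_real (hermite_fun n x / sqrt (fact n)) * z ^ n)"
  \<comment> \<open>This makes \<open>norm z / r\<close> at most 1/2, so a geometric series
    dominates; the summand 1 keeps r positive at z = 0. The constant 5/2 below is
    \<open>1 / 2 + 1 / e\<close> at e = 1/2.\<close>
  define r where "r = 2 * norm z + 1"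
  have r: "r > 0" by (simp add: r_def add_nonneg_pos)
  have B: "B \<ge> 0" using order_trans[OF norm_ge_zero bd] .
  have "norm (?h n x) \<le> (B * exp (5 / 2 * r\<^sup>2) * (1 / 2) ^ n) * exp (- x\<^sup>2 / 4)" for n x
  proof -
    have "norm (?h n x) = norm (f x) * ((\<bar>hermite_fun n x\<bar> / sqrt (fact n)) * norm z ^ n)"
      by (simp add: norm_mult norm_power norm_divide)
    also have "\<dots> \<le> B * ((exp (- x\<^sup>2 / 4) * (exp (5 / 2 * r\<^sup>2) / r ^ n)) * norm z ^ n)"
      using abs_hermite_fun_le[of "1 / 2" r n x] r B
      by (intro mult_mono bd) auto
    also have "\<dots> = (B * exp (5 / 2 * r\<^sup>2) * exp (- x\<^sup>2 / 4)) * (norm z / r) ^ n"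
      by (simp add: power_divide)
    also have "\<dots> \<le> (B * exp (5 / 2 * r\<^sup>2) * exp (- x\<^sup>2 / 4)) * (1 / 2) ^ n"
      using B r by (intro mult_left_mono power_mono) (auto simp: r_def field_simps)
    finally show ?thesis by (simp add: mult_ac)
  qed
  then have "(\<lambda>n. LINT x|lborel. ?h n x) sums (LINT x|lborel. (\<Sum>n. ?h n x))"
    by (intro sums_integral_gaussian_bound[where M = "\<lambda>n. B * exp (5 / 2 * r\<^sup>2) * (1 / 2) ^ n"])
      (auto intro!: summable_mult summable_geometric)
  moreover have "(\<Sum>n. ?h n x) = f x * bargmann_kernel x z" for x
    using sums_mult[OF hermite_fun_generating_function] by (rule sums_unique[symmetric])
  moreover have "(LINT x|lborel. ?h n x) = hermite_coeff f n / of_real (sqrt (fact n)) * z ^ n" for n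
  proof -
    have "?h n x = (f x * complex_of_real (hermite_fun n x)) * (z ^ n / of_real (sqrt (fact n)))" for x
      by simp
    then show ?thesis
      by (simp only: hermite_coeff_def integral_mult_left_zero) simp
  qed
  ultimately show ?thesis by simp
qed

lemma integral_exp_quadratic:
  fixes a :: complex
  shows "(LINT x|lborel. exp (- (of_real x)\<^sup>2 / 2 + a * of_real x)) = of_real (sqrt (2 * pi)) * exp (a\<^sup>2 / 2)"
proof -
  let ?b = "Im a" and ?c = "Re a"
  \<comment> \<open>A real shift by \<open>Re a\<close> removes the real linear term; what remains
    is the characteristic function of the normal law at \<open>Im a\<close>, so no contour shift is
    involved.\<close>
  have "(LINT x|lborel. exp (- (of_real x)\<^sup>2 / 2 + a * of_real x)) =
      (LINT x|lborel. exp (- (of_real (?c + 1 * x))\<^sup>2 / 2 + a * of_real (?c + 1 * x)))"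
    by (subst lborel_integral_real_affine[where c = 1 and t = ?c]) auto
  also have "\<dots> = (LINT x|lborel. (of_real (sqrt (2 * pi)) * exp (of_real ?c * a - (of_real ?c)\<^sup>2 / 2)) *
      (std_normal_density x *\<^sub>R iexp (?b * x)))"
  proof (rule Bochner_Integration.integral_cong[OF refl])
    fix x
    have "- (of_real (?c + 1 * x))\<^sup>2 / 2 + a * of_real (?c + 1 * x) =
      (of_real ?c * a - (of_real ?c)\<^sup>2 / 2) + (of_real (- x\<^sup>2 / 2) + \<i> * of_real (?b * x))"
      by (simp add: complex_eq_iff power2_eq_square field_simps)
    then have "exp (- (of_real (?c + 1 * x))\<^sup>2 / 2 + a * of_real (?c + 1 * x)) =
      exp (of_real ?c * a - (of_real ?c)\<^sup>2 / 2) * (of_real (exp (- x\<^sup>2 / 2)) * iexp (?b * x))"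
      by (simp only: exp_add exp_of_real)
    then show "exp (- (of_real (?c + 1 * x))\<^sup>2 / 2 + a * of_real (?c + 1 * x)) =
      (of_real (sqrt (2 * pi)) * exp (of_real ?c * a - (of_real ?c)\<^sup>2 / 2)) *
      (std_normal_density x *\<^sub>R iexp (?b * x))"
      by (simp add: std_normal_density_def scaleR_conv_of_real)
  qed
  also have "\<dots> = of_real (sqrt (2 * pi)) * exp (of_real ?c * a - (of_real ?c)\<^sup>2 / 2) * char std_normal_distribution ?b"
    unfolding integral_mult_right_zero char_def by (subst integral_density) auto
  also have "\<dots> = of_real (sqrt (2 * pi)) * (exp (of_real ?c * a - (of_real ?c)\<^sup>2 / 2) * exp (of_real (- ?b\<^sup>2 / 2)))"
    by (simp only: char_std_normal_distribution exp_of_real mult.assoc)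
  also have "exp (of_real ?c * a - (of_real ?c)\<^sup>2 / 2) * exp (of_real (- ?b\<^sup>2 / 2)) = exp (a\<^sup>2 / 2)"
    unfolding exp_add[symmetric]
    by (rule arg_cong[where f = exp]) (simp add: complex_eq_iff power2_eq_square field_simps)
  finally show ?thesis .
qed

text \<open>On the kernel the Fourier transform acts as the rotation of z by -i. The integrand is
  again a Gaussian with a complex linear term, so the previous integral applies.\<close>

lemma integral_cis_bargmann_kernel:
  "(LINT y|lborel. cis (- (x * y)) * bargmann_kernel y z) =
     of_real (sqrt (2 * pi)) * bargmann_kernel x (- \<i> * z)"
proof -
  let ?a = "of_real (sqrt 2) * z - \<i> * of_real x"
  have "cis (- (x * y)) * bargmann_kernel y z = (of_real (1 / sqrt (sqrt pi)) * exp (- z\<^sup>2 / 2)) *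
      exp (- (of_real y)\<^sup>2 / 2 + ?a * of_real y)" for y
    unfolding bargmann_kernel_def cis_conv_exp
    by (simp add: mult_ac flip: exp_add) (simp add: algebra_simps)
  then have "(LINT y|lborel. cis (- (x * y)) * bargmann_kernel y z) =
      of_real (1 / sqrt (sqrt pi)) * exp (- z\<^sup>2 / 2) * (of_real (sqrt (2 * pi)) * exp (?a\<^sup>2 / 2))"
    by (simp only: integral_mult_right_zero integral_exp_quadratic)
  also have "\<dots> = of_real (sqrt (2 * pi)) * (of_real (1 / sqrt (sqrt pi)) * (exp (- z\<^sup>2 / 2) * exp (?a\<^sup>2 / 2)))"
    by simp
  also have "exp (- z\<^sup>2 / 2) * exp (?a\<^sup>2 / 2) =
      exp (- (of_real x)\<^sup>2 / 2 + of_real (sqrt 2 * x) * (- \<i> * z) - (- \<i> * z)\<^sup>2 / 2)"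
  proof -
    have "complex_of_real (sqrt 2) * (complex_of_real (sqrt 2) * w) = 2 * w" for w
      by (simp add: mult.assoc[symmetric] flip: of_real_mult)
    then have "- z\<^sup>2 / 2 + ?a\<^sup>2 / 2 = - (of_real x)\<^sup>2 / 2 + of_real (sqrt 2 * x) * (- \<i> * z) - (- \<i> * z)\<^sup>2 / 2"
      by (simp add: power2_eq_square field_simps)
    then show ?thesis by (simp only: exp_add[symmetric])
  qed
  finally show ?thesis by (simp only: bargmann_kernel_def)
qed

text \<open>Up to \<open>sqrt (2 * pi)\<close>, the Hermite coefficients of the character
  \<open>cis (- (x * y))\<close> are the Fourier transforms of the \<open>h_n\<close> at x. Their
  generating function is the rotated kernel, and comparing coefficients of \<open>z^n\<close> gives
  the eigenvalue.\<close>

lemma fourier_hermite_fun: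
  "fourier (\<lambda>x. complex_of_real (hermite_fun n x)) x = (- \<i>) ^ n * complex_of_real (hermite_fun n x)"
proof -
  let ?f = "\<lambda>y. cis (- (x * y))"
  have [measurable]: "?f \<in> borel_measurable lborel"
    unfolding cis_conv_exp by measurable
  have 1: "(\<lambda>n. hermite_coeff ?f n / of_real (sqrt (fact n)) * z ^ n) sums
      (of_real (sqrt (2 * pi)) * bargmann_kernel x (- \<i> * z))" for z
    using hermite_coeff_generating_function[of ?f 1 z] by (simp only: integral_cis_bargmann_kernel) simp
  have "(\<lambda>n. of_real (sqrt (2 * pi)) * (of_real (hermite_fun n x / sqrt (fact n)) * (- \<i> * z) ^ n)) sums
      (of_real (sqrt (2 * pi)) * bargmann_kernel x (- \<i> * z))" for z
    by (intro sums_mult hermite_fun_generating_function)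
  then have 2: "(\<lambda>n. of_real (sqrt (2 * pi)) * of_real (hermite_fun n x / sqrt (fact n)) * (- \<i>) ^ n * z ^ n) sums
      (of_real (sqrt (2 * pi)) * bargmann_kernel x (- \<i> * z))" for z
    by (simp only: power_mult_distrib mult.assoc)
  have "hermite_coeff ?f n / of_real (sqrt (fact n)) =
      of_real (sqrt (2 * pi)) * of_real (hermite_fun n x / sqrt (fact n)) * (- \<i>) ^ n"
    unfolding entire_power_series_coeff[OF 1] entire_power_series_coeff[OF 2] ..
  then have "hermite_coeff ?f n = of_real (sqrt (2 * pi)) * ((- \<i>) ^ n * complex_of_real (hermite_fun n x))"
    by (simp add: field_simps)
  then show ?thesis
    by (simp add: fourier_def hermite_coeff_def)
qed

text \<open>Fubini together with the rotation rule: evaluating the kernel at \<open>i z\<close>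
  compensates the rotation by -i. This converts decay of the Fourier transform into growth bounds in
  the rotated variable.\<close>

lemma bargmann_fourier:
  assumes f: "integrable lborel f"
  shows "(LINT x|lborel. f x * bargmann_kernel x z) =
         (LINT y|lborel. fourier f y * bargmann_kernel y (\<i> * z))"
proof -
  have [measurable]: "f \<in> borel_measurable lborel" using f by simp
  let ?k = "\<lambda>y. bargmann_kernel y (\<i> * z)"
  have k: "integrable lborel ?k"
  proof (rule Bochner_Integration.integrable_bound)
    show "integrable lborel (\<lambda>x::real. exp (5 / 2 * (norm z)\<^sup>2) * exp (- (1 / 4) * (x - 0)\<^sup>2))"
      by (intro integrable_mult_right integrable_gaussian) simp
    show "AE x in lborel. norm (?k x) \<le> norm (exp (5 / 2 * (norm z)\<^sup>2) * exp (- (1 / 4) * (x - 0)\<^sup>2))"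
    proof (rule AE_I2)
      fix x
      show "norm (?k x) \<le> norm (exp (5 / 2 * (norm z)\<^sup>2) * exp (- (1 / 4) * (x - 0)\<^sup>2))"
        using norm_bargmann_kernel_le[of "1 / 2" x "\<i> * z"]
        by (simp add: norm_mult field_simps flip: exp_add)
    qed
  qed simp
  let ?g = "\<lambda>x y. f x * (cis (- (y * x)) * ?k y)"
  have "integrable (lborel \<Otimes>\<^sub>M lborel) (case_prod ?g)"
  proof (rule lborel_pair.Fubini_integrable)
    show "case_prod ?g \<in> borel_measurable (lborel \<Otimes>\<^sub>M lborel)"
      unfolding cis_conv_exp by measurable
    have "(LINT y|lborel. norm (case_prod ?g (x, y))) = norm (f x) * (LINT y|lborel. norm (?k y))" for x
      by (simp add: norm_mult)
    then show "integrable lborel (\<lambda>x. LINT y|lborel. norm (case_prod ?g (x, y)))"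
      using f by simp
    have "integrable lborel (\<lambda>y. cis (- (y * x)) * ?k y)" for x
      by (rule Bochner_Integration.integrable_bound[OF k])
        (auto simp: norm_mult cis_conv_exp)
    then show "AE x in lborel. integrable lborel (\<lambda>y. case_prod ?g (x, y))"
      by simp
  qed
  then have *: "(LINT y|lborel. LINT x|lborel. ?g x y) = (LINT x|lborel. LINT y|lborel. ?g x y)"
    by (rule lborel_pair.Fubini_integral)
  have "(LINT y|lborel. ?g x y) = of_real (sqrt (2 * pi)) * (f x * bargmann_kernel x z)" for x
    using integral_cis_bargmann_kernel[of x "\<i> * z"] by (simp add: mult_ac)
  moreover have "(LINT x|lborel. ?g x y) = of_real (sqrt (2 * pi)) * (fourier f y * ?k y)" for y
  proof -
    have "(LINT x|lborel. ?g x y) = (LINT x|lborel. (cis (- (y * x)) * f x) * ?k y)"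
      by (simp add: mult_ac)
    then show ?thesis by (simp add: fourier_def)
  qed
  ultimately have "complex_of_real (sqrt (2 * pi)) * (LINT x|lborel. f x * bargmann_kernel x z) =
      of_real (sqrt (2 * pi)) * (LINT y|lborel. fourier f y * ?k y)"
    using * by (simp only: integral_mult_right_zero)
  then show ?thesis by simp
qed

section \<open>A Phragmen--Lindelof argument\<close>

text \<open>
  The logarithmic form of the sector theorem: with \<open>z = exp w\<close> the half-strip is a sector of
  opening less than \<open>\<pi> / 2\<close>, in which order-two growth is subcritical.
\<close>

lemma phragmen_lindelof_strip:
  fixes f :: "complex \<Rightarrow> complex"
  assumes "f holomorphic_on UNIV" and "0 < d" "d < pi / 4"
    and growth: "\<And>w. \<lbrakk>0 \<le> Re w; \<bar>Im w\<bar> \<le> d\<rbrakk> \<Longrightarrow> norm (f w) \<le> A * exp (k * exp (2 * Re w))"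
    and left: "\<And>w. \<lbrakk>Re w = 0; \<bar>Im w\<bar> \<le> d\<rbrakk> \<Longrightarrow> norm (f w) \<le> M"
    and sides: "\<And>w. \<lbrakk>0 \<le> Re w; \<bar>Im w\<bar> = d\<rbrakk> \<Longrightarrow> norm (f w) \<le> M"
    and w: "0 \<le> Re w" "\<bar>Im w\<bar> \<le> d"
  shows "norm (f w) \<le> M"
proof -
  \<comment> \<open>The midpoint of 2 and \<open>pi / (2 * d)\<close>: above 2, so
    \<open>exp (p * Re w)\<close> dominates order-two growth, and with
    \<open>p * d < pi / 2\<close>, so \<open>exp (p * w)\<close> has positive real part throughout
    the strip.\<close>
  define p where "p = pi / (4 * d) + 1"
  have p: "2 < p" "p * d < pi / 2"
    using assms(2,3) by (auto simp: p_def field_simps)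
  define c where "c = cos (p * d)"
  have c: "c > 0"
    using p assms(2) unfolding c_def by (intro cos_gt_zero_pi) (auto intro: less_trans[of _ 0])
  have M: "M \<ge> 0"
    using order_trans[OF norm_ge_zero left[of 0]] assms(2) by simp
  have damp: "exp (p * Re v) * c \<le> Re (exp (of_real p * v))" if "\<bar>Im v\<bar> \<le> d" for v
  proof -
    have "\<bar>p * Im v\<bar> \<le> p * d"
      using that p(1) by (simp add: abs_mult)
    then have "cos (p * d) \<le> cos \<bar>p * Im v\<bar>"
      using p assms(2) by (intro cos_monotone_0_pi_le) auto
    then show ?thesis by (simp add: Re_exp c_def)
  qed
  \<comment> \<open>The damped function satisfies the bound with an excess h, which keeps the target
    positive even for M = 0; both the damping and the excess disappear as h tends to 0.\<close>
  have main: "norm (f w * exp (- of_real h * exp (of_real p * w))) \<le> M + h" if h: "h > 0" for h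
  proof -
    let ?f = "\<lambda>v. f v * exp (- of_real h * exp (of_real p * v))"
    have norm_f: "norm (?f v) \<le> norm (f v) * exp (- h * (exp (p * Re v) * c))" if "\<bar>Im v\<bar> \<le> d" for v
      using damp[OF that] h by (simp add: norm_mult mult_left_mono)
    have norm_f': "norm (?f v) \<le> norm (f v)" if "\<bar>Im v\<bar> \<le> d" for v
      using h c by (intro order_trans[OF norm_f[OF that] mult_right_le_one_le]) auto
    \<comment> \<open>A right edge L is chosen so far out that the damping defeats the growth there.
      Replacing A by \<open>\<bar>A\<bar> + 1\<close> gives the logarithm a positive
      argument.\<close>
    have "eventually (\<lambda>L. k * exp (2 * L) - h * c * exp (p * L) \<le> ln (M + h) - ln (\<bar>A\<bar> + 1)) at_top"
      using h c p(1) by real_asymp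
    then have "eventually (\<lambda>L. k * exp (2 * L) - h * c * exp (p * L) \<le> ln (M + h) - ln (\<bar>A\<bar> + 1)
        \<and> Re w \<le> L) at_top"
      by (intro eventually_conj eventually_ge_at_top)
    then obtain L where L: "k * exp (2 * L) - h * c * exp (p * L) \<le> ln (M + h) - ln (\<bar>A\<bar> + 1)"
        "Re w \<le> L"
      using eventually_happens'[OF trivial_limit_at_top_linorder] by blast
    let ?S = "cbox (Complex 0 (- d)) (Complex L d)"
    have right: "norm (?f v) \<le> M + h" if "Re v = L" "\<bar>Im v\<bar> \<le> d" for v
    proof -
      define E where "E = exp (- h * (exp (p * L) * c))"
      have "norm (?f v) \<le> norm (f v) * E"
        using norm_f[OF that(2)] that(1) by (simp only: E_def)
      also have "\<dots> \<le> (A * exp (k * exp (2 * L))) * E"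
        using growth[of v] that w(1) L(2) by (intro mult_right_mono) (auto simp: E_def)
      also have "\<dots> \<le> ((\<bar>A\<bar> + 1) * exp (k * exp (2 * L))) * E"
        by (intro mult_right_mono) (auto simp: E_def)
      also have "\<dots> = (\<bar>A\<bar> + 1) * exp (k * exp (2 * L) - h * c * exp (p * L))"
        by (simp add: E_def exp_diff exp_minus field_simps)
      also have "\<dots> \<le> (\<bar>A\<bar> + 1) * exp (ln (M + h) - ln (\<bar>A\<bar> + 1))"
        using L(1) by (intro mult_left_mono) auto
      also have "\<dots> = M + h"
        using M h by (simp add: exp_diff)
      finally show ?thesis .
    qed
    show ?thesis
    proof (rule maximum_modulus_frontier[of ?f ?S])
      fix v assume "v \<in> frontier ?S"
      then have v: "v \<in> ?S" "v \<notin> box (Complex 0 (- d)) (Complex L d)"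
        by (auto simp: frontier_def interior_cbox)
      then have *: "0 \<le> Re v" "Re v \<le> L" "\<bar>Im v\<bar> \<le> d"
        by (auto simp: in_cbox_complex_iff)
      from v * consider "Re v = 0" | "Re v = L" | "\<bar>Im v\<bar> = d"
        by (fastforce simp: in_box_complex_iff)
      then show "norm (?f v) \<le> M + h"
      proof cases
        case 1 then show ?thesis using left[of v] norm_f'[of v] * h by linarith
      next
        case 2 then show ?thesis using right * by blast
      next
        case 3 then show ?thesis using sides[of v] norm_f'[of v] * h by linarith
      qed
    next
      show "?f holomorphic_on interior ?S"
        by (intro holomorphic_intros holomorphic_on_subset[OF assms(1)]) auto
      show "continuous_on (closure ?S) ?f"
        by (intro continuous_intros holomorphic_on_imp_continuous_on holomorphic_on_subset[OF assms(1)]) auto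
      show "w \<in> ?S"
        using w L(2) by (auto simp: in_cbox_complex_iff)
    qed simp
  qed
  have "((\<lambda>h. norm (f w * exp (- of_real h * exp (of_real p * w)))) \<longlongrightarrow>
      norm (f w * exp (- of_real 0 * exp (of_real p * w)))) (at_right 0)"
    by (intro tendsto_intros)
  moreover have "((\<lambda>h. M + h) \<longlongrightarrow> M + 0) (at_right 0)"
    by (intro tendsto_intros)
  moreover have "eventually (\<lambda>h. norm (f w * exp (- of_real h * exp (of_real p * w))) \<le> M + h) (at_right 0)"
    using eventually_at_right_less[of 0] by eventually_elim (rule main)
  ultimately show ?thesis
    using tendsto_le[OF trivial_limit_at_right_real] by fastforce
qed

text \<open>Within slope t of an axis the hypothesis for that axis already suffices, since the other
  coordinate is small. Between the two rays of slope t and 1/t, outside the unit disc, the strip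
  theorem applies; the constant \<open>exp (1 / 2)\<close> comes from the arc
  \<open>norm z = 1\<close>.\<close>

lemma quadrant_bound:
  fixes F :: "complex \<Rightarrow> complex"
  assumes hol: "F holomorphic_on UNIV" and t: "0 < t" "t < 1"
    and re: "\<And>z. norm (F z) \<le> C * exp (t\<^sup>2 / 2 * (Re z)\<^sup>2 + (Im z)\<^sup>2 / 2)"
    and im: "\<And>z. norm (F z) \<le> C * exp ((Re z)\<^sup>2 / 2 + t\<^sup>2 / 2 * (Im z)\<^sup>2)"
    and z: "0 \<le> Re z" "0 \<le> Im z"
  shows "norm (F z) \<le> C * exp (1 / 2) * exp (t * (norm z)\<^sup>2)"
proof -
  have C: "C \<ge> 0"
    using order_trans[OF norm_ge_zero re[of 0]] by simp
  have t2: "t\<^sup>2 \<le> t" "t\<^sup>2 \<le> 1"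
    using t by (auto simp: power2_eq_square mult_le_one)
  \<comment> \<open>This crude bound supplies the a priori order-two growth in the sector and the
    bounds in the unit disc and on its boundary arc.\<close>
  have half: "norm (F v) \<le> C * exp ((norm v)\<^sup>2 / 2)" for v
  proof -
    have "t\<^sup>2 * (Re v)\<^sup>2 \<le> (Re v)\<^sup>2"
      using t2 by (intro mult_left_le_one_le) auto
    then have "t\<^sup>2 / 2 * (Re v)\<^sup>2 + (Im v)\<^sup>2 / 2 \<le> (norm v)\<^sup>2 / 2"
      by (simp add: cmod_power2)
    then show ?thesis
      using C by (intro order_trans[OF re[of v]] mult_left_mono) auto
  qed
  have weaken: "norm (F z) \<le> C * exp (1 / 2) * exp (t * (norm z)\<^sup>2)"
    if "norm (F z) \<le> C * exp a" "a \<le> 1 / 2 + t * (norm z)\<^sup>2" for a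
    using that C by (intro order_trans[OF that(1)]) (simp add: mult.assoc mult_left_mono flip: exp_add)
  have near_axis: "t\<^sup>2 / 2 * a\<^sup>2 + b\<^sup>2 / 2 \<le> 1 / 2 + t * (a\<^sup>2 + b\<^sup>2)" if "0 \<le> b" "b \<le> t * a" for a b
  proof -
    have "b\<^sup>2 \<le> t\<^sup>2 * a\<^sup>2"
      using that by (metis power_mono power_mult_distrib)
    moreover have "t\<^sup>2 * a\<^sup>2 \<le> t * a\<^sup>2"
      using t2 by (intro mult_right_mono) auto
    moreover have "0 \<le> t * b\<^sup>2" using t by simp
    ultimately show ?thesis by (simp add: distrib_left)
  qed
  consider "Im z \<le> t * Re z" | "Re z \<le> t * Im z" | "norm z \<le> 1"
    | "t * Re z < Im z" "t * Im z < Re z" "1 < norm z"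
    by linarith
  then show ?thesis
  proof cases
    case 1
    then show ?thesis
      using near_axis[of "Im z" "Re z"] z by (intro weaken[OF re]) (simp add: cmod_power2)
  next
    case 2
    then show ?thesis
      using near_axis[of "Re z" "Im z"] z by (intro weaken[OF im]) (simp add: cmod_power2 add_ac)
  next
    case 3
    then have "(norm z)\<^sup>2 / 2 \<le> 1 / 2" by (simp add: power_le_one)
    moreover have "0 \<le> t * (norm z)\<^sup>2" using t by simp
    ultimately show ?thesis by (intro weaken[OF half]) linarith
  next
    case 4
    have pos: "0 < Re z" "0 < Im z"
      using 4 z t by (smt (verit) mult_nonneg_nonneg)+
    \<comment> \<open>The two rays lie at angles phi and \<open>pi / 2 - phi\<close>, so d is the
      half-opening of the sector about the diagonal.\<close>
    define phi where "phi = arctan t"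
    define d where "d = pi / 4 - phi"
    have phi: "0 < phi" "phi < pi / 4"
      using t arctan_less_iff[of t 1] by (auto simp: phi_def arctan_one)
    have tan_phi: "sin phi = t * cos phi"
      using phi pi_gt_zero tan_arctan[of t] cos_gt_zero_pi[of phi]
      by (simp add: phi_def tan_def field_simps)
    \<comment> \<open>Logarithmic coordinate rotated by \<open>pi / 4\<close>: the diagonal becomes
      the centre line \<open>Im v = 0\<close>, and the unit arc becomes
      \<open>Re v = 0\<close>.\<close>
    define g where "g v = exp (v + \<i> * of_real (pi / 4))" for v
    \<comment> \<open>The factor has modulus \<open>exp (- t * Re z * Im z)\<close>, which exactly cancels the growth of
      \<open>F\<close> on the two rays \<open>Im z = t * Re z\<close> and \<open>Re z = t * Im z\<close>.\<close>
    define f where "f v = F (g v) * exp (\<i> * of_real (t / 2) * (g v)\<^sup>2)" for v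
    have hol_g: "g holomorphic_on UNIV"
      unfolding g_def by (intro holomorphic_intros)
    have hol_Fg: "(\<lambda>v. F (g v)) holomorphic_on UNIV"
      using holomorphic_on_compose[OF hol_g, of F] holomorphic_on_subset[OF hol] by (simp add: o_def)
    have g_simps: "norm (g v) = exp (Re v)" "Re (g v) = exp (Re v) * cos (Im v + pi / 4)"
        "Im (g v) = exp (Re v) * sin (Im v + pi / 4)" for v
      by (simp_all add: g_def Re_exp Im_exp)
    have norm_f: "norm (f v) = norm (F (g v)) * exp (- t * Re (g v) * Im (g v))" for v
      by (simp add: f_def norm_mult power2_eq_square)
    have g_pos: "0 \<le> Re (g v)" "0 \<le> Im (g v)" if "\<bar>Im v\<bar> \<le> d" for v
      using that phi unfolding g_simps d_def
      by (auto intro!: mult_nonneg_nonneg cos_ge_zero sin_ge_zero)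
    have f_le_F: "norm (f v) \<le> norm (F (g v))" if "\<bar>Im v\<bar> \<le> d" for v
      unfolding norm_f using g_pos[OF that] t by (intro mult_right_le_one_le) auto
    have f_half: "norm (f v) \<le> C * exp (1 / 2 * exp (2 * Re v))" if "\<bar>Im v\<bar> \<le> d" for v
      using order_trans[OF f_le_F[OF that] half] by (simp add: g_simps flip: exp_double)
    let ?w = "Ln z - \<i> * of_real (pi / 4)"
    have z0: "z \<noteq> 0" using pos by auto
    have "norm (f ?w) \<le> C * exp (1 / 2)"
    proof (rule phragmen_lindelof_strip[where f = f and d = d and A = C and k = "1 / 2"])
      show "f holomorphic_on UNIV"
        unfolding f_def by (intro holomorphic_intros hol_Fg hol_g)
      show "0 < d" "d < pi / 4" using phi by (auto simp: d_def)
      show "norm (f v) \<le> C * exp (1 / 2 * exp (2 * Re v))" if "\<bar>Im v\<bar> \<le> d" for v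
        using f_half[OF that] .
      show "norm (f v) \<le> C * exp (1 / 2)" if "Re v = 0" "\<bar>Im v\<bar> \<le> d" for v
        using f_half[OF that(2)] that(1) by simp
      show "norm (f v) \<le> C * exp (1 / 2)" if v: "\<bar>Im v\<bar> = d" for v
      proof -
        consider "Im v = - d" | "Im v = d" using v by linarith
        then have "norm (f v) \<le> C"
        proof cases
          case 1
          then have "Im (g v) = t * Re (g v)"
            by (simp add: g_simps d_def tan_phi)
          then have "t\<^sup>2 / 2 * (Re (g v))\<^sup>2 + (Im (g v))\<^sup>2 / 2 = t * Re (g v) * Im (g v)"
            by (simp add: power2_eq_square)
          then show ?thesis
            using re[of "g v"] unfolding norm_f by (simp add: exp_minus field_simps)
        next
          case 2
          then have "Im v + pi / 4 = pi / 2 - phi" by (simp add: d_def)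
          then have "Re (g v) = t * Im (g v)"
            unfolding g_simps by (simp add: cos_diff sin_diff tan_phi)
          then have "(Re (g v))\<^sup>2 / 2 + t\<^sup>2 / 2 * (Im (g v))\<^sup>2 = t * Re (g v) * Im (g v)"
            by (simp add: power2_eq_square)
          then show ?thesis
            using im[of "g v"] unfolding norm_f by (simp add: exp_minus field_simps)
        qed
        moreover have "C \<le> C * exp (1 / 2)"
          using C by (simp add: mult_le_cancel_left1)
        ultimately show ?thesis by linarith
      qed
      show "0 \<le> Re ?w" using 4 z0 by simp
      have "Im (Ln z) = arctan (Im z / Re z)"
        using pos Arg_eq_Im_Ln[OF z0] arg_conv_arctan[of z] by simp
      moreover have "phi \<le> arctan (Im z / Re z)"
        unfolding phi_def using 4 pos by (simp add: arctan_le_iff pos_le_divide_eq less_imp_le)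
      moreover have "arctan (Im z / Re z) \<le> pi / 2 - phi"
      proof -
        have "phi \<le> arctan (Re z / Im z)"
          unfolding phi_def using 4 pos by (simp add: arctan_le_iff pos_le_divide_eq less_imp_le)
        then show ?thesis
          using arctan_inverse[of "Im z / Re z"] pos by (simp add: sgn_if)
      qed
      ultimately show "\<bar>Im ?w\<bar> \<le> d"
        by (auto simp: d_def)
    qed
    moreover have "g ?w = z"
      using z0 by (simp add: g_def)
    ultimately have "norm (F z) * exp (- t * Re z * Im z) \<le> C * exp (1 / 2)"
      unfolding norm_f by simp
    then have "norm (F z) \<le> C * exp (1 / 2) * exp (t * Re z * Im z)"
      by (simp add: exp_minus field_simps)
    then have "norm (F z) \<le> C * exp (1 / 2 + t * Re z * Im z)"
      by (simp only: exp_add mult.assoc)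
    moreover have "Re z * Im z \<le> (norm z)\<^sup>2"
      using sum_squares_bound[of "Re z" "Im z"] mult_pos_pos[OF pos] by (simp add: cmod_power2)
    then have "t * Re z * Im z \<le> t * (norm z)\<^sup>2"
      using t by (simp add: mult.assoc)
    ultimately show ?thesis by (intro weaken) auto
  qed
qed

text \<open>Multiplication by a power of i carries the first quadrant to any other one and either
  preserves or exchanges the two growth hypotheses, so the pair is invariant.\<close>

lemma quadratic_growth_from_axes:
  fixes F :: "complex \<Rightarrow> complex"
  assumes hol: "F holomorphic_on UNIV" and t: "0 < t" "t < 1"
    and re: "\<And>z. norm (F z) \<le> C * exp (t\<^sup>2 / 2 * (Re z)\<^sup>2 + (Im z)\<^sup>2 / 2)"
    and im: "\<And>z. norm (F z) \<le> C * exp ((Re z)\<^sup>2 / 2 + t\<^sup>2 / 2 * (Im z)\<^sup>2)"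
  shows "norm (F z) \<le> C * exp (1 / 2) * exp (t * (norm z)\<^sup>2)"
proof -
  have rot: "norm (F (c * v)) \<le> C * exp (1 / 2) * exp (t * (norm v)\<^sup>2)"
    if "c \<in> {1, \<i>, -1, -\<i>}" "0 \<le> Re v" "0 \<le> Im v" for c v
  proof (rule quadrant_bound[where F = "\<lambda>v. F (c * v)"])
    show "(\<lambda>v. F (c * v)) holomorphic_on UNIV"
      using holomorphic_on_compose[of "\<lambda>v. c * v" UNIV F] holomorphic_on_subset[OF hol]
      by (simp add: o_def holomorphic_intros)
    show "norm (F (c * v)) \<le> C * exp (t\<^sup>2 / 2 * (Re v)\<^sup>2 + (Im v)\<^sup>2 / 2)" for v
      using re[of "c * v"] im[of "c * v"] that(1) by (auto simp: add_ac)
    show "norm (F (c * v)) \<le> C * exp ((Re v)\<^sup>2 / 2 + t\<^sup>2 / 2 * (Im v)\<^sup>2)" for v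
      using re[of "c * v"] im[of "c * v"] that(1) by (auto simp: add_ac)
  qed (use t that in auto)
  consider "0 \<le> Re z" "0 \<le> Im z" | "Re z \<le> 0" "0 \<le> Im z" | "Re z \<le> 0" "Im z \<le> 0" | "0 \<le> Re z" "Im z \<le> 0"
    by linarith
  then show ?thesis
  proof cases
    case 1 then show ?thesis using rot[of 1 z] by simp
  next
    case 2 then show ?thesis using rot[of \<i> "- \<i> * z"] by (simp add: norm_mult)
  next
    case 3 then show ?thesis using rot[of "-1" "- z"] by simp
  next
    case 4 then show ?thesis using rot[of "- \<i>" "\<i> * z"] by (simp add: norm_mult)
  qed
qed

section \<open>Decay of the solution\<close>

text \<open>Powers of the logarithm are negligible against \<open>x^2\<close>, so the weight costs
  an arbitrarily small part of the Gaussian rate. The form \<open>1 * \<bar>x\<bar>\<close> matches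
  \<open>E1F\<close> with c = 1.\<close>

lemma log_power_le_quadratic:
  fixes a d p :: real
  assumes "a > 0" "d > 0" "p > 0"
  shows "\<exists>K. \<forall>x. a * logp (1 * \<bar>x\<bar>) powr p \<le> d * x\<^sup>2 + K"
proof -
  have "eventually (\<lambda>x. a * ln (1 + x) powr p \<le> d * x\<^sup>2) at_top"
    using assms by real_asymp
  then obtain R where R: "\<And>x. x \<ge> R \<Longrightarrow> a * ln (1 + x) powr p \<le> d * x\<^sup>2"
    by (auto simp: eventually_at_top_linorder)
  have "a * logp (1 * \<bar>x\<bar>) powr p \<le> d * x\<^sup>2 + a * ln (1 + \<bar>R\<bar>) powr p" for x
  proof (cases "R \<le> \<bar>x\<bar>")
    case True
    then have "a * logp (1 * \<bar>x\<bar>) powr p \<le> d * x\<^sup>2"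
      using R[of "\<bar>x\<bar>"] by (simp add: logp_def)
    then show ?thesis
      using assms by (simp add: add_increasing2)
  next
    case False
    then have "a * ln (1 + \<bar>x\<bar>) powr p \<le> a * ln (1 + \<bar>R\<bar>) powr p"
      using assms by (intro mult_left_mono powr_mono2) auto
    then show ?thesis
      using assms by (simp add: logp_def add_increasing)
  qed
  then show ?thesis by blast
qed

section \<open>From Gaussian decay to superexponentially small Hermite coefficients\<close>

lemma integral_gaussian: "(LINT x|lborel. exp (- (x - m)\<^sup>2 / 2)) = sqrt (2 * pi)"
proof -
  have "exp (- (x - m)\<^sup>2 / 2) = sqrt (2 * pi) * normal_density m 1 x" for x
    by (simp add: normal_density_def)
  then show ?thesis by simp
qed

text \<open>The factor \<open>exp (x^2 / 2)\<close> of the kernel meets the decay of f and leaves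
  \<open>exp (d * x^2 / 2)\<close>. With v = \<open>Re z / sqrt 2\<close>, the inequality
  \<open>x^2 \<le> 2 * (x - v)^2 + (Re z)^2\<close> moves this to the centre v, and
  \<open>d \<le> 1 / 2\<close> preserves half of the Gaussian there for integration.\<close>

lemma bargmann_transform_bound:
  assumes bd: "\<And>x. norm (f x) \<le> C * exp (- (1 - d) * x\<^sup>2 / 2)" and d: "0 < d" "d \<le> 1 / 2"
  shows "norm (LINT x|lborel. f x * bargmann_kernel x z) \<le>
           C * sqrt (2 * pi) * exp (d / 2 * (Re z)\<^sup>2 + (Im z)\<^sup>2 / 2)"
proof -
  let ?v = "Re z / sqrt 2" and ?E = "exp (d / 2 * (Re z)\<^sup>2 + (Im z)\<^sup>2 / 2)"
  let ?g = "\<lambda>x. C * ?E * exp (- (x - ?v)\<^sup>2 / 2)"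
  have C: "C \<ge> 0"
    using order_trans[OF norm_ge_zero bd[of 0]] by simp
  have g: "integrable lborel ?g"
    using integrable_gaussian[of "1 / 2" ?v] by simp
  have le: "norm (f x * bargmann_kernel x z) \<le> ?g x" for x
  proof -
    have "0 \<le> (x - 2 * ?v)\<^sup>2" by simp
    also have "\<dots> = 2 * (x - ?v)\<^sup>2 + (Re z)\<^sup>2 - x\<^sup>2"
      by (simp add: power2_diff power_divide power_mult_distrib)
    finally have "d * x\<^sup>2 \<le> d * (2 * (x - ?v)\<^sup>2 + (Re z)\<^sup>2)"
      using d by (intro mult_left_mono) auto
    moreover have "2 * d * (x - ?v)\<^sup>2 \<le> 1 * (x - ?v)\<^sup>2"
      using d by (intro mult_right_mono) auto
    ultimately have e: "d * x\<^sup>2 \<le> (x - ?v)\<^sup>2 + d * (Re z)\<^sup>2"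
      by (simp add: distrib_left)
    have "norm (bargmann_kernel x z) \<le> exp (- (x - ?v)\<^sup>2 + (x\<^sup>2 + (Im z)\<^sup>2) / 2)"
      using pi_gt3 unfolding norm_bargmann_kernel(1) by (simp add: divide_le_eq mult_le_cancel_left1)
    then have "norm (f x * bargmann_kernel x z) \<le>
        C * exp (- (1 - d) * x\<^sup>2 / 2) * exp (- (x - ?v)\<^sup>2 + (x\<^sup>2 + (Im z)\<^sup>2) / 2)"
      unfolding norm_mult using C bd by (intro mult_mono) auto
    also have "\<dots> = C * exp (d * x\<^sup>2 / 2 - (x - ?v)\<^sup>2 + (Im z)\<^sup>2 / 2)"
      by (simp add: field_simps flip: exp_add)
    also have "\<dots> \<le> C * exp (d / 2 * (Re z)\<^sup>2 + (Im z)\<^sup>2 / 2 + - (x - ?v)\<^sup>2 / 2)"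
      using C e by (intro mult_left_mono) auto
    finally show ?thesis by (simp only: exp_add mult.assoc)
  qed
  have "norm (LINT x|lborel. f x * bargmann_kernel x z) \<le> (LINT x|lborel. ?g x)"
  proof (cases "integrable lborel (\<lambda>x. f x * bargmann_kernel x z)")
    case True
    then show ?thesis
      using le g by (intro order_trans[OF integral_norm_bound] integral_mono) auto
  next
    \<comment> \<open>The integral of a non-integrable function is 0 by convention, so nonnegativity
      of the right-hand side is enough.\<close>
    case False
    then show ?thesis
      using C by (simp add: not_integrable_integral_eq integral_nonneg)
  qed
  then show ?thesis
    unfolding integral_mult_right_zero integral_gaussian by (simp only: mult_ac)
qed

lemma hermite_coeff_superexponential:
  assumes f: "integrable lborel f"
    and bd: "\<And>d. 0 < d \<Longrightarrow> \<exists>C. \<forall>x. norm (f x) \<le> C * exp (- (1 - d) * x\<^sup>2 / 2)"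
    and bdF: "\<And>d. 0 < d \<Longrightarrow> \<exists>C. \<forall>x. norm (fourier f x) \<le> C * exp (- (1 - d) * x\<^sup>2 / 2)"
    and K: "K > 0"
  shows "\<exists>C. \<forall>n. norm (hermite_coeff f n) \<le> C * exp (- K * real n)"
proof -
  \<comment> \<open>Growth of type t makes the nth coefficient at most a constant times
    \<open>exp n * sqrt t ^ n\<close>. This t makes \<open>sqrt t\<close> equal to
    \<open>exp (- (K + 1))\<close>, the extra 1 paying for \<open>exp n\<close>.\<close>
  define t where "t = exp (- (2 * (K + 1)))"
  have t: "0 < t" "t \<le> 1 / 2"
  proof -
    have "1 + 2 * (K + 1) \<le> exp (2 * (K + 1))"
      by (rule exp_ge_add_one_self)
    moreover have "2 \<le> 1 + 2 * (K + 1)" using K by simp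
    ultimately have "2 \<le> exp (2 * (K + 1))" by (rule order_trans[rotated])
    then have "inverse (exp (2 * (K + 1))) \<le> inverse 2"
      by (rule le_imp_inverse_le) simp
    then show "t \<le> 1 / 2" unfolding t_def exp_minus by simp
  qed (simp add: t_def)
  have sqrt_t: "sqrt t = exp (- (K + 1))"
    by (simp add: t_def real_sqrt_unique power2_eq_square flip: exp_add)
  \<comment> \<open>The decay parameter is \<open>t^2\<close> because growth \<open>t^2 / 2\<close>
    along each axis yields type t in the plane.\<close>
  have t2: "0 < t\<^sup>2" "t\<^sup>2 \<le> 1 / 2"
    using t mult_mono[of t "1 / 2" t "1 / 2"] by (auto simp: power2_eq_square)
  obtain C1 where C1: "\<And>x. norm (f x) \<le> C1 * exp (- (1 - t\<^sup>2) * x\<^sup>2 / 2)"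
    using bd[OF t2(1)] by blast
  obtain C2 where C2: "\<And>x. norm (fourier f x) \<le> C2 * exp (- (1 - t\<^sup>2) * x\<^sup>2 / 2)"
    using bdF[OF t2(1)] by blast
  define C where "C = max C1 C2 * sqrt (2 * pi)"
  have C1': "norm (f x) \<le> max C1 C2 * exp (- (1 - t\<^sup>2) * x\<^sup>2 / 2)" for x
    by (rule order_trans[OF C1 mult_right_mono]) auto
  have C2': "norm (fourier f x) \<le> max C1 C2 * exp (- (1 - t\<^sup>2) * x\<^sup>2 / 2)" for x
    by (rule order_trans[OF C2 mult_right_mono]) auto
  \<comment> \<open>At d = 1 the Gaussian factor is constant, so the decay hypothesis reads as
    boundedness.\<close>
  obtain B where B: "\<And>x. norm (f x) \<le> B"
    using bd[of 1] by auto
  define F where "F z = (LINT x|lborel. f x * bargmann_kernel x z)" for z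
  have sums: "(\<lambda>n. hermite_coeff f n / of_real (sqrt (fact n)) * z ^ n) sums F z" for z
    unfolding F_def using f B by (intro hermite_coeff_generating_function) auto
  have growth: "norm (F z) \<le> C * exp (1 / 2) * exp (t * (norm z)\<^sup>2)" for z
  proof (rule quadratic_growth_from_axes)
    show "F holomorphic_on UNIV"
      using sums by (rule entire_power_series_holomorphic)
    show "norm (F z) \<le> C * exp (t\<^sup>2 / 2 * (Re z)\<^sup>2 + (Im z)\<^sup>2 / 2)" for z
      unfolding F_def C_def using C1' t2 by (rule bargmann_transform_bound)
    show "norm (F z) \<le> C * exp ((Re z)\<^sup>2 / 2 + t\<^sup>2 / 2 * (Im z)\<^sup>2)" for z
      \<comment> \<open>Passing to \<open>i z\<close> exchanges the squares of the real and
        imaginary parts, so decay of the Fourier transform controls the other axis.\<close>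
      using bargmann_transform_bound[OF C2' t2, of "\<i> * z"]
      unfolding F_def C_def bargmann_fourier[OF f] by (simp add: add_ac)
  qed (use t in auto)
  have C: "C \<ge> 0"
    using order_trans[OF norm_ge_zero growth[of 0]] by (simp add: zero_le_mult_iff)
  have "norm (hermite_coeff f n) \<le> (C * exp (1 / 2) * exp 1) * exp (- K * real n)" for n
  proof -
    \<comment> \<open>This radius minimises \<open>exp (t * r^2) / r^n\<close> up to a factor
      exponential in n, and its power cancels the bound on \<open>sqrt (n!)\<close>.\<close>
    define r where "r = sqrt (real n + 1) / sqrt t"
    have r: "r > 0" "t * r\<^sup>2 = real n + 1"
      using t by (auto simp: r_def power_divide)
    have "norm (hermite_coeff f n / of_real (sqrt (fact n))) \<le> C * exp (1 / 2) * exp (t * r\<^sup>2) / r ^ n"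
      using growth by (intro entire_power_series_Cauchy[OF sums r(1)]) metis
    then have "norm (hermite_coeff f n) \<le> sqrt (fact n) * (C * exp (1 / 2) * exp (t * r\<^sup>2) / r ^ n)"
      by (simp add: norm_divide field_simps)
    also have "\<dots> \<le> sqrt (real n + 1) ^ n * (C * exp (1 / 2) * exp (t * r\<^sup>2) / r ^ n)"
      using C r(1) by (intro mult_right_mono sqrt_fact_le) auto
    also have "\<dots> = C * exp (1 / 2) * exp (real n + 1) * sqrt t ^ n"
      unfolding r(2) by (simp add: r_def power_divide)
    also have "sqrt t ^ n = exp (- (K + 1) * real n)"
      by (simp add: sqrt_t exp_of_nat_mult[symmetric] mult.commute)
    also have "C * exp (1 / 2) * exp (real n + 1) * exp (- (K + 1) * real n) =
        C * exp (1 / 2) * (exp (real n + 1) * exp (- (K + 1) * real n))"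
      by simp
    also have "exp (real n + 1) * exp (- (K + 1) * real n) = exp 1 * exp (- K * real n)"
      by (simp add: algebra_simps flip: exp_add)
    finally show ?thesis by simp
  qed
  then show ?thesis by blast
qed

text \<open>The exponential cost of the Hermite bounds is absorbed by the coefficients, leaving a
  summable \<open>exp (- n)\<close>. The phases \<open>cis ((2 * n + 1) * t)\<close> and the Fourier
  eigenvalues have modulus 1, so one constant serves all t and both functions.\<close>

lemma hermite_sol_gaussian_bounds:
  assumes c: "\<And>K. K > 0 \<Longrightarrow> \<exists>C. \<forall>n. norm (hermite_coeff f n) \<le> C * exp (- K * real n)"
    and e: "0 < e"
  shows "\<exists>C\<ge>0. \<forall>t x. norm (hermite_sol f x t) \<le> C * exp (- (1 - e) * x\<^sup>2 / 2) \<and>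
           norm (fourier (\<lambda>z. hermite_sol f z t) x) \<le> C * exp (- (1 - e) * x\<^sup>2 / 2)"
proof -
  \<comment> \<open>Stated for arbitrary e because it is used twice: at the given e for the final
    estimate, and at 1/2 to justify termwise integration.\<close>
  have term_bound: "\<exists>C\<ge>0. \<forall>n x. norm (hermite_coeff f n) * \<bar>hermite_fun n x\<bar> \<le>
      (C * exp (- real n)) * exp (- (1 - e) * x\<^sup>2 / 2)" if e: "0 < e" for e
  proof -
    define K where "K = 1 / 2 + 1 / e"
    have K: "K > 0" using e by (simp add: K_def add_pos_pos)
    then obtain C where C: "\<And>n. norm (hermite_coeff f n) \<le> C * exp (- (K + 1) * real n)"
      using c[of "K + 1"] by auto
    have C0: "C \<ge> 0"
      using order_trans[OF norm_ge_zero C[of 0]] by simp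
    have "norm (hermite_coeff f n) * \<bar>hermite_fun n x\<bar> \<le>
        ((C * exp K) * exp (- real n)) * exp (- (1 - e) * x\<^sup>2 / 2)" for n x
    proof -
      have "norm (hermite_coeff f n) * \<bar>hermite_fun n x\<bar> \<le>
          (C * exp (- (K + 1) * real n)) * (exp (- (1 - e) * x\<^sup>2 / 2) * exp (K * (real n + 1)))"
        unfolding K_def using C0 C[unfolded K_def] abs_hermite_fun_le_exp[OF e]
        by (intro mult_mono) auto
      also have "\<dots> = C * (exp (- (K + 1) * real n) * exp (K * (real n + 1))) * exp (- (1 - e) * x\<^sup>2 / 2)"
        by simp
      also have "exp (- (K + 1) * real n) * exp (K * (real n + 1)) = exp K * exp (- real n)"
        by (simp add: algebra_simps flip: exp_add)
      finally show ?thesis by (simp add: mult_ac)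
    qed
    then show ?thesis using C0 by (intro exI[of _ "C * exp K"]) auto
  qed
  have geom: "summable (\<lambda>n. exp (- real n))"
  proof -
    have "exp (- real n) = exp (-1) ^ n" for n
      by (simp flip: exp_of_nat_mult)
    then show ?thesis by (simp add: summable_geometric)
  qed
  obtain C where C: "C \<ge> 0" "\<And>n x. norm (hermite_coeff f n) * \<bar>hermite_fun n x\<bar> \<le>
      (C * exp (- real n)) * exp (- (1 - e) * x\<^sup>2 / 2)"
    using term_bound[OF e] by blast
  define S where "S = C * (\<Sum>n. exp (- real n))"
  have S: "S \<ge> 0"
    unfolding S_def using C(1) geom by (intro mult_nonneg_nonneg suminf_nonneg) auto
  \<comment> \<open>Only the moduli of the terms enter, so this covers the solution and its Fourier
    transform alike.\<close>
  have sum_bound: "norm (\<Sum>n. a n) \<le> S * exp (- (1 - e) * x\<^sup>2 / 2)"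
    if a: "\<And>n. norm (a n) = norm (hermite_coeff f n) * \<bar>hermite_fun n x\<bar>" for a :: "nat \<Rightarrow> complex" and x
  proof -
    have "norm (\<Sum>n. a n) \<le> (\<Sum>n. (C * exp (- real n)) * exp (- (1 - e) * x\<^sup>2 / 2))"
      using C(2) by (intro norm_suminf_le summable_mult2 summable_mult geom) (simp add: a)
    also have "\<dots> = S * exp (- (1 - e) * x\<^sup>2 / 2)"
      unfolding S_def using geom by (simp add: suminf_mult suminf_mult2[symmetric] summable_mult)
    finally show ?thesis .
  qed
  have "norm (hermite_sol f x t) \<le> S * exp (- (1 - e) * x\<^sup>2 / 2)" for x t
    unfolding hermite_sol_def by (rule sum_bound) (simp add: norm_mult)
  moreover have "norm (fourier (\<lambda>z. hermite_sol f z t) x) \<le> S * exp (- (1 - e) * x\<^sup>2 / 2)" for x t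
  proof -
    obtain D where D: "\<And>n x. norm (hermite_coeff f n) * \<bar>hermite_fun n x\<bar> \<le>
        (D * exp (- real n)) * exp (- x\<^sup>2 / 4)"
      using term_bound[of "1 / 2"] by auto
    let ?b = "\<lambda>n. cis ((2 * real n + 1) * t) * hermite_coeff f n"
    let ?f = "\<lambda>n z. cis (- (x * z)) * (?b n * complex_of_real (hermite_fun n z))"
    have "(\<lambda>n. LINT z|lborel. ?f n z) sums (LINT z|lborel. (\<Sum>n. ?f n z))"
    proof (rule sums_integral_gaussian_bound)
      show "?f n \<in> borel_measurable lborel" for n
        unfolding cis_conv_exp by measurable
      show "norm (?f n z) \<le> (D * exp (- real n)) * exp (- z\<^sup>2 / 4)" for n z
        using D by (simp add: norm_mult)
    qed (intro summable_mult geom)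
    moreover have "(LINT z|lborel. ?f n z) = of_real (sqrt (2 * pi)) *
        (?b n * ((- \<i>) ^ n * complex_of_real (hermite_fun n x)))" for n
    proof -
      have "?f n z = ?b n * (cis (- (x * z)) * complex_of_real (hermite_fun n z))" for z
        by simp
      then have "(LINT z|lborel. ?f n z) =
          ?b n * (LINT z|lborel. cis (- (x * z)) * complex_of_real (hermite_fun n z))"
        by (simp only: integral_mult_right_zero)
      also have "(LINT z|lborel. cis (- (x * z)) * complex_of_real (hermite_fun n z)) =
          of_real (sqrt (2 * pi)) * fourier (\<lambda>z. complex_of_real (hermite_fun n z)) x"
        by (simp add: fourier_def)
      finally show ?thesis by (simp add: fourier_hermite_fun)
    qed
    moreover have "(\<Sum>n. ?f n z) = cis (- (x * z)) * hermite_sol f z t" for z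
    proof -
      have "summable (\<lambda>n. ?b n * complex_of_real (hermite_fun n z))"
      proof (rule summable_comparison_test')
        show "summable (\<lambda>n. (D * exp (- real n)) * exp (- z\<^sup>2 / 4))"
          by (intro summable_mult2 summable_mult geom)
        show "norm (?b n * complex_of_real (hermite_fun n z)) \<le> (D * exp (- real n)) * exp (- z\<^sup>2 / 4)" for n
          using D by (simp add: norm_mult)
      qed
      then show ?thesis
        unfolding hermite_sol_def by (rule suminf_mult)
    qed
    ultimately have "(\<lambda>n. of_real (sqrt (2 * pi)) * (?b n * ((- \<i>) ^ n * complex_of_real (hermite_fun n x))))
        sums (LINT z|lborel. cis (- (x * z)) * hermite_sol f z t)"
      by simp
    then have "(\<lambda>n. complex_of_real (1 / sqrt (2 * pi)) * (of_real (sqrt (2 * pi)) *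
        (?b n * ((- \<i>) ^ n * complex_of_real (hermite_fun n x)))))
        sums fourier (\<lambda>z. hermite_sol f z t) x"
      unfolding fourier_def by (rule sums_mult)
    then have "fourier (\<lambda>z. hermite_sol f z t) x =
        (\<Sum>n. ?b n * ((- \<i>) ^ n * complex_of_real (hermite_fun n x)))"
      by (simp add: sums_iff)
    also have "norm \<dots> \<le> S * exp (- (1 - e) * x\<^sup>2 / 2)"
      by (rule sum_bound) (simp add: norm_mult norm_power)
    finally show ?thesis .
  qed
  ultimately show ?thesis using S by blast
qed

text \<open>Both corrections lower the exponent: the argument of the square root is at most 1, and
  real \<open>sqrt\<close> is monotone also at negative arguments, while the subtracted logarithmic
  term is nonnegative.\<close>

lemma expo_le:
  assumes "lam > 0"
  shows "expo s lam y x \<le> x\<^sup>2 / 2"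
proof -
  have "P_sy s y x \<le> 1"
    unfolding P_sy_def by (subst real_sqrt_le_1_iff) auto
  then have "x\<^sup>2 / 2 * P_sy s y x \<le> x\<^sup>2 / 2"
    by (simp add: mult_left_le)
  moreover have "0 \<le> lam * 2 powr (2 * s / (1 - 2 * s)) * ln (1 + sqrt (2 * \<bar>x\<bar>)) powr (1 / (1 - 2 * s))"
    using assms by simp
  ultimately show ?thesis by (simp add: expo_def)
qed

text \<open>\<open>P_sy\<close> tends to 1 and the logarithmic term is of lower order than
  \<open>x^2\<close>. Nonnegativity is what allows the factor in front of the exponent to be
  increased in the final comparison.\<close>

lemma expo_eventually_nonneg:
  assumes "0 < s" "s < 1 / 2" "lam > 0" "y > 0"
  shows "\<exists>R. \<forall>x. \<bar>x\<bar> \<ge> R \<longrightarrow> 0 \<le> expo s lam y x"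
proof -
  define a b q r where "a = 2 * s / y" and "b = lam * 2 powr (2 * s / (1 - 2 * s))"
    and "q = 2 * s / (1 - 2 * s)" and "r = 1 / (1 - 2 * s)"
  have "a > 0" "b > 0" "q > 0" "r > 0"
    using assms by (auto simp: a_def b_def q_def r_def)
  then have "eventually (\<lambda>x. x\<^sup>2 / 2 * sqrt (1 - 2 / x\<^sup>2 * (a * ln (1 + sqrt (2 * x))) powr q)
      - b * ln (1 + sqrt (2 * x)) powr r \<ge> 0) at_top"
    by real_asymp
  then obtain R where R: "\<And>x. x \<ge> R \<Longrightarrow> x\<^sup>2 / 2 * sqrt (1 - 2 / x\<^sup>2 * (a * ln (1 + sqrt (2 * x))) powr q)
      - b * ln (1 + sqrt (2 * x)) powr r \<ge> 0"
    by (auto simp: eventually_at_top_linorder)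
  have "0 \<le> expo s lam y x" if "\<bar>x\<bar> \<ge> R" for x
    using R[OF that] by (simp add: expo_def P_sy_def a_def b_def q_def r_def)
  then show ?thesis by blast
qed

section \<open>Comparison of the Gaussian bounds with the claimed exponents\<close>

theorem theorem1p3:
  fixes s lam y :: real and u0 :: "real \<Rightarrow> complex"
  assumes s: "0 < s" "s < 1 / 2"
    and lam: "lam > 0"
    and y: "y = ((1 - 2 * s) / lam) powr ((1 - 2 * s) / (2 * s)) * s"
    and u0: "u0 \<in> E1F 1 1 lam (\<lambda>r. (logp r) powr (1 / (1 - 2 * s)))"
  shows "\<forall>\<epsilon>>0.
     (lam < lambda_s s \<longrightarrow>
        (\<exists>C R. \<forall>t x. \<bar>x\<bar> \<ge> R \<longrightarrow>
            cmod (hermite_sol u0 x t) \<le> C * exp (- (1 - \<epsilon>) * expo s lam y x)) \<and>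
        (\<exists>C R. \<forall>t x. \<bar>x\<bar> \<ge> R \<longrightarrow>
            cmod (fourier (\<lambda>z. hermite_sol u0 z t) x) \<le> C * exp (- (1 - \<epsilon>) * expo s lam y x))) \<and>
     (\<forall>\<theta> :: real \<Rightarrow> real.
        continuous_on {0<..2 powr (1 / (2 * s) - 1)} \<theta> \<and>
        (\<forall>r\<in>{0<..2 powr (1 / (2 * s) - 1)}. 0 \<le> \<theta> r \<and> \<theta> r \<le> 1 \<and>
              \<theta> r \<le> (2 * r) powr (2 * s) / 2) \<and>
        lam \<ge> lambda_s s \<longrightarrow>
        (\<exists>C R. \<forall>t x. \<bar>x\<bar> \<ge> R \<longrightarrow>
            cmod (hermite_sol u0 x t) \<le>
              C * exp (- (1 - \<epsilon>) * \<theta> y powr (1 / (2 * s)) * expo s lam y x)) \<and>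
        (\<exists>C R. \<forall>t x. \<bar>x\<bar> \<ge> R \<longrightarrow>
            cmod (fourier (\<lambda>z. hermite_sol u0 z t) x) \<le>
              C * exp (- (1 - \<epsilon>) * \<theta> y powr (1 / (2 * s)) * expo s lam y x)))"
proof -
  let ?w = "\<lambda>r. (logp r) powr (1 / (1 - 2 * s))"
  obtain C0 where int: "integrable lborel u0"
    and C0: "\<And>x. norm (u0 x) \<le> C0 * exp (- 1 * x\<^sup>2 / 2 + lam * ?w (1 * \<bar>x\<bar>))"
      "\<And>x. norm (fourier u0 x) \<le> C0 * exp (- 1 * x\<^sup>2 / 2 + lam * ?w (1 * \<bar>x\<bar>))"
    using u0 unfolding E1F_def by blast
  have gaussian: "\<exists>C. \<forall>x. norm (f x) \<le> C * exp (- (1 - d) * x\<^sup>2 / 2)"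
    if f: "\<And>x. norm (f x) \<le> C0 * exp (- 1 * x\<^sup>2 / 2 + lam * ?w (1 * \<bar>x\<bar>))" and d: "0 < d"
    for f :: "real \<Rightarrow> complex" and d
  proof -
    have "C0 \<ge> 0"
      using order_trans[OF norm_ge_zero f[of 0]] by (simp add: zero_le_mult_iff)
    obtain K where K: "\<And>x. lam * ?w (1 * \<bar>x\<bar>) \<le> d / 2 * x\<^sup>2 + K"
      using log_power_le_quadratic[of lam "d / 2" "1 / (1 - 2 * s)"] lam d s by auto
    have "norm (f x) \<le> (C0 * exp K) * exp (- (1 - d) * x\<^sup>2 / 2)" for x
    proof -
      have "norm (f x) \<le> C0 * exp (K + - (1 - d) * x\<^sup>2 / 2)"
        using K[of x] \<open>C0 \<ge> 0\<close>
        by (intro order_trans[OF f] mult_left_mono) (auto simp: field_simps)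
      then show ?thesis by (simp only: exp_add mult.assoc)
    qed
    then show ?thesis by blast
  qed
  have coeff: "\<exists>C. \<forall>n. norm (hermite_coeff u0 n) \<le> C * exp (- K * real n)" if "K > 0" for K
    using int gaussian[OF C0(1)] gaussian[OF C0(2)] that by (rule hermite_coeff_superexponential)
  have "y > 0" using s lam y by simp
  then obtain R where R: "\<And>x. \<bar>x\<bar> \<ge> R \<Longrightarrow> 0 \<le> expo s lam y x"
    using expo_eventually_nonneg[OF s lam] by blast
  \<comment> \<open>Both parts of the claim are instances, with m equal to
    \<open>1 - \<epsilon>\<close> or to that number times the power of
    \<open>\<theta> y\<close>.\<close>
  have main: "(\<exists>C R. \<forall>t x. \<bar>x\<bar> \<ge> R \<longrightarrow> cmod (hermite_sol u0 x t) \<le> C * exp (- m * expo s lam y x)) \<and>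
      (\<exists>C R. \<forall>t x. \<bar>x\<bar> \<ge> R \<longrightarrow> cmod (fourier (\<lambda>z. hermite_sol u0 z t) x) \<le> C * exp (- m * expo s lam y x))"
    if m: "m < 1" for m
  proof -
    \<comment> \<open>Truncation at 0 covers negative m, which occurs for
      \<open>\<epsilon> > 1\<close>; then \<open>1 - e = max m 0\<close>.\<close>
    define e where "e = 1 - max m 0"
    have e: "0 < e" using m by (simp add: e_def)
    obtain C where C: "C \<ge> 0" "\<And>t x. norm (hermite_sol u0 x t) \<le> C * exp (- (1 - e) * x\<^sup>2 / 2)"
        "\<And>t x. norm (fourier (\<lambda>z. hermite_sol u0 z t) x) \<le> C * exp (- (1 - e) * x\<^sup>2 / 2)"
      using hermite_sol_gaussian_bounds[OF coeff e] by blast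
    have "C * exp (- (1 - e) * x\<^sup>2 / 2) \<le> C * exp (- m * expo s lam y x)" if "\<bar>x\<bar> \<ge> R" for x
    proof -
      have "m * expo s lam y x \<le> max m 0 * expo s lam y x"
        using R[OF that] by (intro mult_right_mono) auto
      also have "\<dots> \<le> max m 0 * (x\<^sup>2 / 2)"
        by (intro mult_left_mono expo_le lam) auto
      finally show ?thesis
        using C(1) by (intro mult_left_mono) (auto simp: e_def)
    qed
    then show ?thesis using C by (meson order_trans)
  qed
  show ?thesis
  proof (intro allI impI conjI; (elim conjE)?)
    fix e :: real assume e: "e > 0"
    show "\<exists>C R. \<forall>t x. \<bar>x\<bar> \<ge> R \<longrightarrow> cmod (hermite_sol u0 x t) \<le> C * exp (- (1 - e) * expo s lam y x)"
      "\<exists>C R. \<forall>t x. \<bar>x\<bar> \<ge> R \<longrightarrow>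
            cmod (fourier (\<lambda>z. hermite_sol u0 z t) x) \<le> C * exp (- (1 - e) * expo s lam y x)"
      using main[of "1 - e"] e by auto
    fix \<theta> :: "real \<Rightarrow> real"
    assume th: "\<forall>r\<in>{0<..2 powr (1 / (2 * s) - 1)}. 0 \<le> \<theta> r \<and> \<theta> r \<le> 1 \<and>
              \<theta> r \<le> (2 * r) powr (2 * s) / 2" and "lam \<ge> lambda_s s"
    \<comment> \<open>Here \<open>lam \<ge> lambda_s s\<close> places y in the domain of
      \<open>\<theta>\<close>: with q as below, y is
      \<open>((1 - 2 * s) / lam) powr (1 / q) * s\<close>, and the factor s cancels, leaving
      \<open>2 powr (1 / q)\<close>.\<close>
    have "y \<le> 2 powr (1 / (2 * s) - 1)"
    proof -
      let ?q = "2 * s / (1 - 2 * s)"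
      have q: "?q > 0" using s by simp
      have "(1 - 2 * s) / lam \<le> 2 * s powr (- ?q)"
        using \<open>lam \<ge> lambda_s s\<close> s lam unfolding lambda_s_def
        by (simp add: powr_minus field_simps)
      then have "((1 - 2 * s) / lam) powr (1 / ?q) \<le> (2 * s powr (- ?q)) powr (1 / ?q)"
        using s lam q by (intro powr_mono2) auto
      also have "\<dots> = 2 powr (1 / ?q) * s powr (- 1)"
        using s q by (simp add: powr_mult powr_powr)
      finally have "y \<le> 2 powr (1 / ?q) * s powr (- 1) * s"
        using s y by (simp add: pos_le_divide_eq)
      also have "\<dots> = 2 powr (1 / ?q)"
        using s by (simp add: powr_minus)
      also have "1 / ?q = 1 / (2 * s) - 1"
        using s by (simp add: field_simps)
      finally show ?thesis .
    qed
    with \<open>y > 0\<close> th have "0 \<le> \<theta> y" "\<theta> y \<le> 1" by auto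
    then have p: "0 \<le> \<theta> y powr (1 / (2 * s))" "\<theta> y powr (1 / (2 * s)) \<le> 1"
      using s by (auto intro: powr_le1)
    have "(1 - e) * \<theta> y powr (1 / (2 * s)) < 1"
    proof (cases "e \<le> 1")
      case True
      then show ?thesis using p e mult_left_le[of "\<theta> y powr (1 / (2 * s))" "1 - e"] by linarith
    next
      case False
      then have "(1 - e) * \<theta> y powr (1 / (2 * s)) \<le> 0"
        using p by (intro mult_nonpos_nonneg) auto
      then show ?thesis by linarith
    qed
    from main[OF this]
    show "\<exists>C R. \<forall>t x. \<bar>x\<bar> \<ge> R \<longrightarrow> cmod (hermite_sol u0 x t) \<le>
              C * exp (- (1 - e) * \<theta> y powr (1 / (2 * s)) * expo s lam y x)"
      "\<exists>C R. \<forall>t x. \<bar>x\<bar> \<ge> R \<longrightarrow> cmod (fourier (\<lambda>z. hermite_sol u0 z t) x) \<le>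
              C * exp (- (1 - e) * \<theta> y powr (1 / (2 * s)) * expo s lam y x)"
      by (simp_all only: minus_mult_left)
  qed
qed

end
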